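(* Let $F:S^2\to\mathbb{R}$ be a continuous even function, i.e. $F(x)=F(-x)$ for all $x\in S^2$, and let $\{\pm v_i \mid 1\le i\le 4\}$ be the vertices of a cube inscribed to the unit sphere $S^2\subset\mathbb{R}^3$. Then there exists $A\in SO(3)$ such that $F(\pm Av_1)=F(\pm Av_2)=F(\pm Av_3)=F(\pm Av_4)$.
   Context: $S^2$ is the unit sphere of $\mathbb{R}^3$ centred at the origin. A cube is inscribed to $S^2$ if all its eight vertices lie on $S^2$; these vertices then form four antipodal pairs $\pm v_1,\dots,\pm v_4$. Since $F$ is even, $F(\pm Av_i)$ denotes the common value $F(Av_i)=F(-Av_i)$. *)

theory Defs
  imports "HOL-Analysis.Analysis"
begin

text \<open>
  The vertex set of an arbitrary cube (any centre, size and orientation): the image of the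
  reference vertices \<open>(\<plusminus>1, \<plusminus>1, \<plusminus>1)\<close> under a similarity. The centre is not required to be
  the origin; inscribedness is expressed separately, by containment in the sphere.
\<close>

definition is_cube_vertex_set :: "(real^3) set \<Rightarrow> bool" where
  "is_cube_vertex_set V \<longleftrightarrow>
     (\<exists>c r Q. r > 0 \<and> orthogonal_matrix Q \<and>
        V = (\<lambda>x. c + r *\<^sub>R (Q *v x)) ` {x. \<forall>i. x $ i = 1 \<or> x $ i = -1})"

end

theory Submission
  imports Defs
begin

text \<open>
  Write \<open>f\<^sub>k A = F (A d\<^sub>k)\<close> for the four diagonals \<open>d\<^sub>k\<close> of a cube and a rotation \<open>A\<close>. Rotations of the
  cube act on \<open>SO(3)\<close> from the right and permute the \<open>f\<^sub>k\<close>, so the coincidences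
  \<open>f\<^sub>0 = f\<^sub>1 = f\<^sub>2 = f\<^sub>3\<close> come in orbits. Three equations on a closed three-dimensional manifold have
  generically finitely many solutions, and the number of orbits modulo 2 does not change when \<open>F\<close> is
  deformed, because the group acts freely. For \<open>F\<close> a quadratic form with distinct eigenvalues there is
  exactly one orbit for the full rotation group of the cube: the rotations that diagonalise the form.
  A count modulo 2 survives passage to the dihedral subgroup of order 8 that fixes an axis through two
  face centres, since its index 3 is odd. So the number of orbits is odd and a solution exists.

  The proof below carries out this count combinatorially, without transversality. Euler angles
  replace \<open>SO(3)\<close> by \<open>\<real>\<^sup>3\<close>, and the dihedral group together with the ambiguity of Euler angles becomes
  a group of affine maps acting freely on \<open>\<real>\<^sup>3\<close> and by permutations on the indices \<open>k\<close>
  (\<open>vertex_value_act\<close>). A fine grid is cut into simplices, here called chambers, in a way invariant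
  under this group. Each grid point is labelled by an index \<open>k\<close> for which \<open>f\<^sub>k\<close> is largest, chosen
  compatibly with the group. On a chamber carrying all four labels, a rainbow, each \<open>f\<^sub>k\<close> is the largest
  at one of the corners. At a limit point of rainbow chambers, as the grid is refined, the four functions therefore
  agree (\<open>exists_euler_equal\<close>).

  Rainbow chambers exist because their number up to the group is odd for \<^emph>\<open>every\<close> compatible labelling.
  Changing the label of a single orbit of grid points changes the number by an even amount: the simplices around
  a point form a ball whose boundary is a closed surface, and in a closed surface labelled by four
  letters the number of triangles carrying the three letters other than a given one is, modulo 2, the same
  for every choice of that letter (\<open>link_parity\<close>, \<open>parity_rainbows_upd\<close>). So one labelling decides, and the one that is constant on a
  fundamental box has a single rainbow chamber, next to a corner of the box (\<open>rainbows_at_zero\<close>).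
\<close>

section \<open>Triangles of a closed surface labelled by four letters\<close>

lemma even_card_involution:
  assumes "finite A" "\<And>x. x \<in> A \<Longrightarrow> t x \<in> A" "\<And>x. x \<in> A \<Longrightarrow> t (t x) = x"
    and "\<And>x. x \<in> A \<Longrightarrow> t x \<noteq> x"
  shows "even (card A)"
  using assms
proof (induction A rule: finite_psubset_induct)
  case (psubset A)
  show ?case
  proof (cases "A = {}")
    case False
    then obtain x where x: "x \<in> A" by blast
    have tx: "t x \<in> A" "t x \<noteq> x" "t (t x) = x" using psubset.prems x by auto
    have "even (card (A - {x, t x}))"
    proof (rule psubset.IH)
      show "A - {x, t x} \<subset> A" using x by blast
      show "t y \<in> A - {x, t x}" if "y \<in> A - {x, t x}" for y
        using that psubset.prems(1,2) tx by (metis Diff_iff insert_iff singletonD)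
    qed (use psubset.prems in auto)
    moreover have "card A = card (A - {x, t x}) + card {x, t x}"
    proof -
      have "card ((A - {x, t x}) \<union> {x, t x}) = card (A - {x, t x}) + card {x, t x}"
        using psubset.hyps by (intro card_Un_disjoint) auto
      moreover have "(A - {x, t x}) \<union> {x, t x} = A" using x tx(1) by blast
      ultimately show ?thesis by simp
    qed
    ultimately show ?thesis using tx by simp
  qed simp
qed

lemma insert_eq_four_iff:
  assumes "X \<subseteq> {a, b, c, d}" "a \<noteq> b" "a \<noteq> c" "a \<noteq> d"
  shows "insert a X = {a, b, c, d} \<longleftrightarrow> b \<in> X \<and> c \<in> X \<and> d \<in> X"
proof
  assume *: "insert a X = {a, b, c, d}"
  have "b \<in> insert a X" "c \<in> insert a X" "d \<in> insert a X" unfolding * by simp_all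
  then show "b \<in> X \<and> c \<in> X \<and> d \<in> X" using assms by simp
next
  assume "b \<in> X \<and> c \<in> X \<and> d \<in> X"
  then show "insert a X = {a, b, c, d}" using assms(1) by (intro equalityI) simp_all
qed

text \<open>
  Here \<open>x, y, z\<close> are the labels of a triangle. An edge is a door if its labels are \<open>c\<close> and \<open>d\<close>. A triangle has
  exactly one door if its third label is \<open>a\<close> or \<open>b\<close>, two if it carries only the labels \<open>c\<close> and \<open>d\<close>, and
  none otherwise.
\<close>
lemma count_two_label_facets:
  assumes m: "x = a \<or> x = b \<or> x = c \<or> x = d" "y = a \<or> y = b \<or> y = c \<or> y = d" "z = a \<or> z = b \<or> z = c \<or> z = d"
  and ne: "a \<noteq> b" "a \<noteq> c" "a \<noteq> d" "b \<noteq> c" "b \<noteq> d" "c \<noteq> d"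
  shows "of_bool (insert a {x, y, z} = {a, b, c, d}) + of_bool (insert b {x, y, z} = {a, b, c, d}) +
      2 * of_bool ({x, y, z} = {c, d})
    = of_bool ({y, z} = {c, d}) + of_bool ({x, z} = {c, d}) + (of_bool ({x, y} = {c, d}) :: nat)"
proof -
  have sub: "{x, y, z} \<subseteq> {a, b, c, d}" using m by simp
  have "insert b {x, y, z} = {b, a, c, d} \<longleftrightarrow> a \<in> {x, y, z} \<and> c \<in> {x, y, z} \<and> d \<in> {x, y, z}"
    by (rule insert_eq_four_iff) (use sub ne in \<open>simp_all add: insert_commute\<close>)
  then have 2: "insert b {x, y, z} = {a, b, c, d} \<longleftrightarrow> a \<in> {x, y, z} \<and> c \<in> {x, y, z} \<and> d \<in> {x, y, z}"
    by (simp add: insert_commute)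
  have 3: "{x, y, z} = {c, d} \<longleftrightarrow> c \<in> {x, y, z} \<and> d \<in> {x, y, z} \<and> {x, y, z} \<subseteq> {c, d}"
    unfolding set_eq_subset insert_subset by blast
  show ?thesis
    unfolding insert_eq_four_iff[OF sub ne(1-3)] 2 3 doubleton_eq_iff insert_subset insert_iff empty_iff
    using m by (elim disjE) (simp_all add: ne ne[symmetric])
qed

text \<open>
  The elements of \<open>S\<close> play the role of the triangles of a closed surface, with corner labels \<open>l1, l2, l3\<close>;
  \<open>t j\<close> passes to the other triangle along the edge opposite corner \<open>j\<close>. Every door is thus shared by two
  triangles, so the pairs of a triangle and one of its doors are even in number, and by
  \<open>count_two_label_facets\<close> this number is, modulo 2, the sum of the two cardinalities compared here.
\<close>
lemma link_parity:
  fixes l1 l2 l3 :: "'c \<Rightarrow> int"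
  assumes "finite S"
    and t: "\<And>j C. j \<in> {1, 2, 3::nat} \<Longrightarrow> C \<in> S \<Longrightarrow> t j C \<in> S \<and> t j (t j C) = C \<and> t j C \<noteq> C"
    and l1: "\<And>j C. j \<in> {2, 3} \<Longrightarrow> C \<in> S \<Longrightarrow> l1 (t j C) = l1 C"
    and l2: "\<And>j C. j \<in> {1, 3} \<Longrightarrow> C \<in> S \<Longrightarrow> l2 (t j C) = l2 C"
    and l3: "\<And>j C. j \<in> {1, 2} \<Longrightarrow> C \<in> S \<Longrightarrow> l3 (t j C) = l3 C"
    and range: "\<And>C. C \<in> S \<Longrightarrow> {l1 C, l2 C, l3 C} \<subseteq> L" and L: "card L = 4" "a \<in> L" "b \<in> L"
  shows "even (card {C \<in> S. insert a {l1 C, l2 C, l3 C} = L})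
     \<longleftrightarrow> even (card {C \<in> S. insert b {l1 C, l2 C, l3 C} = L})"
proof (cases "a = b")
  case False
  have "finite L" using L(1) card.infinite by fastforce
  then have "card (L - {a, b}) = 2" using L False by (simp add: card_Diff_subset)
  then obtain c d where cd: "c \<noteq> d" "L - {a, b} = {c, d}" by (auto simp: card_2_iff)
  then have Leq: "L = {a, b, c, d}" and ne: "a \<noteq> c" "a \<noteq> d" "b \<noteq> c" "b \<noteq> d" using L by auto
  define K where "K = {c, d}"
  have E: "even (card {C \<in> S. {l2 C, l3 C} = K})" "even (card {C \<in> S. {l1 C, l3 C} = K})"
     "even (card {C \<in> S. {l1 C, l2 C} = K})"
    using even_card_involution[of "{C \<in> S. {l2 C, l3 C} = K}" "t 1"]
      even_card_involution[of "{C \<in> S. {l1 C, l3 C} = K}" "t 2"]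
      even_card_involution[of "{C \<in> S. {l1 C, l2 C} = K}" "t 3"] assms(1) t l1 l2 l3 by simp_all
  have pt: "of_bool (insert a {l1 C, l2 C, l3 C} = L) + of_bool (insert b {l1 C, l2 C, l3 C} = L) +
      2 * of_bool ({l1 C, l2 C, l3 C} = K)
    = of_bool ({l2 C, l3 C} = K) + of_bool ({l1 C, l3 C} = K) + (of_bool ({l1 C, l2 C} = K) :: nat)"
    if "C \<in> S" for C
  proof -
    have "{l1 C, l2 C, l3 C} \<subseteq> {a, b, c, d}" using range[OF that] by (simp add: Leq)
    then show ?thesis unfolding Leq K_def by (intro count_two_label_facets) (use ne cd(1) False in simp_all)
  qed
  have card_sum: "card {C \<in> S. P C} = (\<Sum>C\<in>S. of_bool (P C))" for P
    using assms(1) by (simp add: Collect_conj_eq Int_commute)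
  have "card {C \<in> S. insert a {l1 C, l2 C, l3 C} = L} + card {C \<in> S. insert b {l1 C, l2 C, l3 C} = L}
      + 2 * card {C \<in> S. {l1 C, l2 C, l3 C} = K}
    = card {C \<in> S. {l2 C, l3 C} = K} + card {C \<in> S. {l1 C, l3 C} = K} + card {C \<in> S. {l1 C, l2 C} = K}"
    unfolding card_sum sum_distrib_left sum.distrib[symmetric] by (rule sum.cong) (use pt in auto)
  with E show ?thesis by presburger
qed simp

section \<open>A crystallographic group acting on grid points and on labels\<close>

text \<open>
  Triples of integers serve both as grid points and as coordinates of group elements.
\<close>
type_synonym point = "int \<times> int \<times> int"

definition sg :: "int \<Rightarrow> int" where
  "sg p = (if even p then 1 else -1)"

text \<open>
  One grid unit is the angle \<open>pi / (2 * n)\<close>, so a full turn has \<open>4 * n\<close> units. Evenness of \<open>n\<close> makes the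
  group below preserve the parity of coordinates, on which the triangulation is built.
\<close>
locale grid =
  fixes n :: int
  assumes n_pos: "0 < n" and n_even: "even n"
begin

text \<open>
  These are the words in three motions that leave the values of \<open>F\<close> on the cube unchanged up to a
  permutation of the diagonals: the half turn \<open>(x, y, z) \<mapsto> (x + 2n, -y, z)\<close> that combines the ambiguity
  of Euler angles with a half turn of the cube about its axis, \<open>(x, y, z) \<mapsto> (x, y + 2n, -z)\<close> from a half turn
  of the cube about a second axis, and the quarter turn \<open>(x, y, z) \<mapsto> (x, y, z + n)\<close>. The function \<open>lab\<close> is the
  corresponding permutation of the four diagonals: \<open>k \<mapsto> k + 2\<close>, \<open>k \<mapsto> -1 - k\<close> and \<open>k \<mapsto> k - 1\<close> for the
  three generators.
\<close>
fun act :: "point \<Rightarrow> point \<Rightarrow> point" where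
  "act (p, q, r) (x, y, z) = (x + 2 * n * p, sg p * y + 2 * n * q, sg q * z + n * r)"

fun lab :: "point \<Rightarrow> int \<Rightarrow> int" where
  "lab (p, q, r) k = (sg q * (k + 2 * p) - (if even q then 0 else 1) - r) mod 4"

fun mult :: "point \<Rightarrow> point \<Rightarrow> point" where
  "mult (p', q', r') (p, q, r) = (p + p', sg p' * q + q', sg q' * r + r')"

fun act_inverse :: "point \<Rightarrow> point" where
  "act_inverse (p, q, r) = (- p, - (sg p * q), - (sg q * r))"

lemma act_act: "act g (act g' v) = act (mult g g') v"
  by (cases g; cases g'; cases v) (auto simp: sg_def algebra_simps)

lemma mult_act_inverse: "mult (act_inverse g) g = (0, 0, 0)" "mult g (act_inverse g) = (0, 0, 0)"
  by (cases g; auto simp: sg_def)+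

lemma act_zero: "act (0, 0, 0) v = v"
  by (cases v) (auto simp: sg_def)

lemma act_act_inverse [simp]: "act (act_inverse g) (act g v) = v" "act g (act (act_inverse g) v) = v"
  by (simp_all add: act_act mult_act_inverse act_zero)

lemma lab_lab: "lab g (lab g' k) = lab (mult g g') k"
proof -
  obtain p q r p' q' r' where g: "g = (p, q, r)" "g' = (p', q', r')" by (metis prod.exhaust)
  have *: "(sg q * ((sg q' * (k + 2 * p') - (if even q' then 0 else 1) - r') mod 4 + 2 * p)
       - (if even q then 0 else 1) - r) mod 4
     = (sg q * ((sg q' * (k + 2 * p') - (if even q' then 0 else 1) - r') + 2 * p)
       - (if even q then 0 else 1) - r) mod 4"
    by (intro mod_diff_cong mod_mult_cong mod_add_cong) auto
  have "4 dvd (sg q * ((sg q' * (k + 2 * p') - (if even q' then 0 else 1) - r') + 2 * p)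
       - (if even q then 0 else 1) - r) -
    (sg (sg p * q' + q) * (k + 2 * (p' + p)) - (if even (sg p * q' + q) then 0 else 1) - (sg q * r' + r))"
    unfolding sg_def by (cases "even q"; cases "even q'"; cases "even p"; simp; presburger)
  then show ?thesis
    unfolding g lab.simps mult.simps * by (simp add: mod_eq_dvd_iff)
qed

lemma lab_range: "lab g k \<in> {0..<4}"
  by (cases g) auto

lemma lab_zero: "k \<in> {0..<4} \<Longrightarrow> lab (0, 0, 0) k = k"
  by (auto simp: sg_def)

lemma lab_image: "lab g ` {0..<4} = {0..<4}"
proof
  show "{0..<4} \<subseteq> lab g ` {0..<4}"
  proof
    fix k :: int assume k: "k \<in> {0..<4}"
    then have "k = lab g (lab (act_inverse g) k)"
      by (metis lab_lab mult_act_inverse(2) lab_zero)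
    then show "k \<in> lab g ` {0..<4}" using lab_range by blast
  qed
qed (use lab_range in blast)

section \<open>A fundamental box and compatible labellings\<close>

text \<open>
  A fundamental domain: every orbit meets the box in exactly one point, and no group element other
  than the identity fixes a point.
\<close>
definition box :: "point set" where
  "box = {0..<2 * n} \<times> {0..<2 * n} \<times> {0..<n}"

text \<open>
  The group element that carries the box onto the copy containing a given point. The coordinates have to be
  determined in this order, since each of the first two decides about a reflection of the next coordinate.
\<close>
fun tile :: "point \<Rightarrow> point" where
  "tile (x, y, z) =
    (let p = x div (2 * n); q = sg p * (sg p * y div (2 * n)) in (p, q, sg q * (sg q * z div n)))"

lemma sg_sg [simp]: "sg p * (sg p * q) = q" "sg p * sg p = 1" "sg (sg p * q) = sg q"
  by (auto simp: sg_def)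

lemma act_inverse_tile_in_box: "act (act_inverse (tile v)) v \<in> box"
proof -
  obtain x y z where v: "v = (x, y, z)" by (metis prod.exhaust)
  define p where "p = x div (2 * n)"
  define q where "q = sg p * (sg p * y div (2 * n))"
  define r where "r = sg q * (sg q * z div n)"
  have t: "tile v = (p, q, r)" by (simp add: v p_def q_def r_def Let_def)
  have s: "sg (- p) = sg p" "sg (- (sg p * q)) = sg q" by (auto simp: sg_def)
  have eq: "act (act_inverse (tile v)) v =
      (x + 2 * n * (- p), sg p * y + 2 * n * (- (sg p * q)), sg q * z + n * (- (sg q * r)))"
    unfolding t unfolding v by (simp add: s)
  have "x + 2 * n * (- p) = x mod (2 * n)"
    by (simp add: p_def minus_mult_div_eq_mod[symmetric])
  moreover have "sg p * y + 2 * n * (- (sg p * q)) = (sg p * y) mod (2 * n)"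
    by (simp add: q_def minus_mult_div_eq_mod[symmetric])
  moreover have "sg q * z + n * (- (sg q * r)) = (sg q * z) mod n"
    by (simp add: r_def minus_mult_div_eq_mod[symmetric])
  ultimately show ?thesis
    unfolding eq using n_pos by (simp add: box_def)
qed

lemma tile_act:
  assumes "w \<in> box" shows "tile (act g w) = g"
proof -
  obtain x y z p q r where v: "w = (x, y, z)" "g = (p, q, r)" by (metis prod.exhaust)
  have b: "0 \<le> x" "x < 2 * n" "0 \<le> y" "y < 2 * n" "0 \<le> z" "z < n"
    using assms by (auto simp: v box_def)
  have p: "(x + 2 * n * p) div (2 * n) = p"
    using b n_pos by (simp)
  have "sg p * (sg p * y + 2 * n * q) = y + 2 * n * (sg p * q)"
    by (auto simp: algebra_simps)
  then have q: "sg p * (sg p * (sg p * y + 2 * n * q) div (2 * n)) = q"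
    using b n_pos by simp
  have "sg q * (sg q * z + n * r) = z + n * (sg q * r)"
    by (auto simp: algebra_simps)
  then have r: "sg q * (sg q * (sg q * z + n * r) div n) = r"
    using b n_pos by simp
  show ?thesis unfolding v act.simps tile.simps Let_def p q r ..
qed

definition rep :: "point \<Rightarrow> point" where
  "rep v = act (act_inverse (tile v)) v"

lemma rep_in_box: "rep v \<in> box"
  by (simp add: rep_def act_inverse_tile_in_box)

lemma act_tile_rep: "act (tile v) (rep v) = v"
  by (simp add: rep_def)

lemma tile_act_mult: "tile (act g v) = mult g (tile v)"
  by (metis act_act act_tile_rep rep_in_box tile_act)

lemma rep_act: "rep (act g v) = rep v"
  by (metis act_act act_act_inverse(1) act_tile_rep rep_def tile_act_mult)

lemma tile_box: "v \<in> box \<Longrightarrow> tile v = (0, 0, 0)"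
  by (metis act_zero tile_act)

lemma rep_box: "v \<in> box \<Longrightarrow> rep v = v"
  by (metis act_tile_rep act_zero tile_box)

text \<open>
  The group acts freely, so labels can be prescribed arbitrarily on the box and continue uniquely to a labelling
  compatible with the group.
\<close>
definition extend :: "(point \<Rightarrow> int) \<Rightarrow> point \<Rightarrow> int" where
  "extend h v = lab (tile v) (h (rep v))"

lemma extend_act: "extend h (act g v) = lab g (extend h v)"
  by (simp add: extend_def lab_lab rep_act tile_act_mult)

lemma extend_range: "extend h v \<in> {0..<4}"
  unfolding extend_def by (rule lab_range)

section \<open>The invariant triangulation and its facets\<close>

text \<open>
  Points of the grid stand for the cells of the cubical subdivision with vertices at the all-even points:
  the odd coordinates are the directions in which the cell extends, so \<open>odds\<close> is its dimension. The
  chambers are the flags of this subdivision, hence the simplices of its barycentric subdivision. This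
  triangulation is invariant under reflections in even coordinate planes, unlike the
  subdivision of cubes along parallel diagonals.
\<close>
definition odds :: "point \<Rightarrow> nat" where
  "odds v = (case v of (x, y, z) \<Rightarrow> of_bool (odd x) + of_bool (odd y) + of_bool (odd z))"

definition face1 :: "int \<Rightarrow> int \<Rightarrow> bool" where
  "face1 x x' \<longleftrightarrow> x' = x \<or> even x \<and> (x' = x + 1 \<or> x' = x - 1)"

definition face :: "point \<Rightarrow> point \<Rightarrow> bool" where
  "face v w = (case v of (x, y, z) \<Rightarrow> case w of (x', y', z') \<Rightarrow> face1 x x' \<and> face1 y y' \<and> face1 z z')"

fun chamber :: "point list \<Rightarrow> bool" where
  "chamber [a, b, c, d] \<longleftrightarrow> odds a = 0 \<and> odds b = 1 \<and> odds c = 2 \<and> odds d = 3 \<and>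
     face a b \<and> face b c \<and> face c d"
| "chamber _ = False"

text \<open>
  Exchanging the \<open>j\<close>-th member of a flag gives the unique neighbour of the simplex across the facet opposite
  that vertex. In coordinates the new vertex is the reflection of the old one in the midpoint of the members
  next to it; at either end the only neighbour counts twice.
\<close>
fun flip :: "nat \<Rightarrow> point list \<Rightarrow> point list" where
  "flip j [a, b, c, d] =
    (if j = 0 then [b + b - a, b, c, d] else if j = 1 then [a, a + c - b, c, d]
     else if j = 2 then [a, b, b + d - c, d] else [a, b, c, c + c - d])"
| "flip _ C = C"

lemma chamberE:
  assumes "chamber C"
  obtains a b c d where "C = [a, b, c, d]" "odds a = 0" "odds b = 1" "odds c = 2" "odds d = 3"
    "face a b" "face b c" "face c d"
  using assms by (cases C rule: chamber.cases) auto

lemma face1_iff: "face1 x x' \<longleftrightarrow> \<bar>x' - x\<bar> \<le> 1 \<and> (odd x \<longrightarrow> x' = x)"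
  unfolding face1_def by (auto simp: abs_if)

lemma odds_act: "odds (act g v) = odds v"
  by (cases g; cases v) (use n_even in \<open>auto simp: odds_def sg_def\<close>)

lemma face_act: "face v w \<Longrightarrow> face (act g v) (act g w)"
  by (cases g; cases v; cases w) (use n_even in \<open>auto simp: face_def face1_iff sg_def\<close>)

lemma chamber_act: "chamber C \<Longrightarrow> chamber (map (act g) C)"
  by (erule chamberE) (simp add: odds_act face_act)

lemma chamber_odds: "chamber C \<Longrightarrow> i < 4 \<Longrightarrow> odds (C ! i) = i"
  by (erule chamberE) (auto simp del: split_paired_All simp: less_Suc_eq numeral_eq_Suc)

lemma chamber_length: "chamber C \<Longrightarrow> length C = 4"
  by (erule chamberE) simp

lemma flip_flip: "flip j (flip j C) = C"
  by (cases "(j, C)" rule: flip.cases) auto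

lemma flip_other: "chamber C \<Longrightarrow> i < 4 \<Longrightarrow> j < 4 \<Longrightarrow> i \<noteq> j \<Longrightarrow> flip j C ! i = C ! i"
  by (erule chamberE) (auto simp: less_Suc_eq numeral_eq_Suc)

lemma face1_flip:
  assumes "face1 x y" "face1 y z"
  shows "face1 x (x + z - y)" "face1 (x + z - y) z"
    and "of_bool (odd (x + z - y)) + of_bool (odd y) = (of_bool (odd x) + of_bool (odd z) :: nat)"
    and "x + z - y = y \<Longrightarrow> x = y"
  using assms unfolding face1_def by auto

text \<open>
  If the dimensions of \<open>a\<close> and \<open>c\<close> differ by 2, exactly two cells lie between them, and the sum of these two
  as vectors is \<open>a + c\<close>.
\<close>
lemma face_flip_middle:
  assumes "face a b" "face b c"
  shows "face a (a + c - b)" "face (a + c - b) c"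
    and "odds (a + c - b) + odds b = odds a + odds c"
    and "a + c - b = b \<Longrightarrow> a = b"
proof -
  obtain x y z x' y' z' x'' y'' z'' where
    e: "a = (x, y, z)" "b = (x', y', z')" "c = (x'', y'', z'')" by (metis prod.exhaust)
  have f: "face1 x x'" "face1 y y'" "face1 z z'" "face1 x' x''" "face1 y' y''" "face1 z' z''"
    using assms by (auto simp: e face_def)
  note k = face1_flip[OF f(1,4)] face1_flip[OF f(2,5)] face1_flip[OF f(3,6)]
  show "face a (a + c - b)" "face (a + c - b) c" using k by (simp_all add: e face_def)
  show "odds (a + c - b) + odds b = odds a + odds c" using k(3,7,11) by (simp add: e odds_def)
  show "a + c - b = b \<Longrightarrow> a = b" using k(4,8,12) by (simp add: e)
qed

lemma face_flip_end:
  assumes "face a b"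
  shows "face (b + b - a) b" "odds (b + b - a) = odds a" "b + b - a = a \<Longrightarrow> a = b"
    and "face a (a + a - b)" "odds (a + a - b) = odds b" "a + a - b = b \<Longrightarrow> a = b"
  using assms by (cases a; cases b; auto simp: face_def face1_iff odds_def)+

lemma flip_chamber:
  assumes "chamber C" shows "chamber (flip j C)"
proof -
  obtain a b c d where C: "C = [a, b, c, d]" "odds a = 0" "odds b = 1" "odds c = 2" "odds d = 3"
    "face a b" "face b c" "face c d" using assms by (rule chamberE)
  have "odds (a + c - b) = 1" "odds (b + d - c) = 2"
    using face_flip_middle(3)[OF C(6,7)] face_flip_middle(3)[OF C(7,8)] C by linarith+
  then show ?thesis
    using C face_flip_middle(1,2)[OF C(6,7)] face_flip_middle(1,2)[OF C(7,8)]
      face_flip_end(1,2)[OF C(6)] face_flip_end(4,5)[OF C(8)]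
    by simp
qed

lemma flip_neq:
  assumes "chamber C" shows "flip j C \<noteq> C"
proof -
  obtain a b c d where C: "C = [a, b, c, d]" "odds a = 0" "odds b = 1" "odds c = 2" "odds d = 3"
    "face a b" "face b c" "face c d" using assms by (rule chamberE)
  have "a \<noteq> b" "b \<noteq> c" "c \<noteq> d" using C by auto
  then show ?thesis
    using C(1) face_flip_middle(4)[OF C(6,7)] face_flip_middle(4)[OF C(7,8)]
      face_flip_end(3)[OF C(6)] face_flip_end(6)[OF C(8)]
    by (simp only: flip.simps) (simp split: if_split, blast)
qed

lemma face_finite: "finite {w. face v w}" "finite {v. face v w}"
proof -
  obtain x y z where v: "v = (x, y, z)" by (metis prod.exhaust)
  obtain x' y' z' where w: "w = (x', y', z')" by (metis prod.exhaust)
  have "{w. face v w} \<subseteq> {x - 1..x + 1} \<times> {y - 1..y + 1} \<times> {z - 1..z + 1}"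
    by (auto simp: v face_def face1_def)
  then show "finite {w. face v w}" by (rule finite_subset) auto
  have "{v. face v w} \<subseteq> {x' - 1..x' + 1} \<times> {y' - 1..y' + 1} \<times> {z' - 1..z' + 1}"
    by (auto simp: w face_def face1_def)
  then show "finite {v. face v w}" by (rule finite_subset) auto
qed

section \<open>The parity of the number of rainbow chambers\<close>

definition rainbow :: "(point \<Rightarrow> int) \<Rightarrow> point list \<Rightarrow> bool" where
  "rainbow h C \<longleftrightarrow> extend h ` set C = {0..<4}"

lemma rainbow_act: "rainbow h (map (act g) C) \<longleftrightarrow> rainbow h C"
proof -
  have *: "rainbow h (map (act g) C)" if "rainbow h C" for g C
  proof -
    have "extend h ` set (map (act g) C) = lab g ` extend h ` set C"
      by (simp add: image_image extend_act)
    then show ?thesis using that lab_image unfolding rainbow_def by simp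
  qed
  from *[of "map (act g) C" "act_inverse g"] *[of C g] show ?thesis
    by (auto simp: comp_def)
qed

text \<open>
  Every orbit of chambers has exactly one member whose \<open>i\<close>-th vertex lies in the box, so the number of
  elements is the number of orbits of rainbow chambers, whatever \<open>i\<close> is. The freedom in \<open>i\<close> is what
  allows to centre the count at a vertex of any dimension.
\<close>
definition rainbows_at :: "nat \<Rightarrow> (point \<Rightarrow> int) \<Rightarrow> point list set" where
  "rainbows_at i h = {C. chamber C \<and> rainbow h C \<and> C ! i \<in> box}"

definition normalize_at :: "nat \<Rightarrow> point list \<Rightarrow> point list" where
  "normalize_at i C = map (act (act_inverse (tile (C ! i)))) C"

lemma normalize_at_normalize_at:
  assumes "length C = 4" "i < 4" "j < 4"
  shows "normalize_at j (normalize_at i C) = normalize_at j C"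
proof -
  have "act (act_inverse (tile (act g w))) (act g v) = act (act_inverse (tile w)) v" for g v w
  proof -
    have "mult (act_inverse (tile (act g w))) g = act_inverse (tile w)"
      by (cases g; cases "tile w") (auto simp: tile_act_mult sg_def)
    then show ?thesis by (simp add: act_act)
  qed
  then show ?thesis using assms by (simp add: normalize_at_def)
qed

lemma normalize_at_id: "C ! i \<in> box \<Longrightarrow> normalize_at i C = C"
  by (simp add: normalize_at_def tile_box act_zero sg_def map_idI)

lemma normalize_at_rainbows:
  "C \<in> rainbows_at j h \<Longrightarrow> i < 4 \<Longrightarrow> normalize_at i C \<in> rainbows_at i h"
  by (auto simp: rainbows_at_def normalize_at_def chamber_act rainbow_act chamber_length act_inverse_tile_in_box)

lemma card_rainbows_at:
  assumes "i < 4" "j < 4" shows "card (rainbows_at i h) = card (rainbows_at j h)"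
proof (rule bij_betw_same_card, rule bij_betw_byWitness)
  show "\<forall>C\<in>rainbows_at i h. normalize_at i (normalize_at j C) = C" "\<forall>C\<in>rainbows_at j h. normalize_at j (normalize_at i C) = C"
    using assms by (auto simp: normalize_at_normalize_at normalize_at_id rainbows_at_def chamber_length)
  show "normalize_at j ` rainbows_at i h \<subseteq> rainbows_at j h" "normalize_at i ` rainbows_at j h \<subseteq> rainbows_at i h"
    using assms normalize_at_rainbows by blast+
qed

lemma finite_star:
  assumes "i < 4" shows "finite {C. chamber C \<and> C ! i = v}"
proof -
  define N where "N = (\<lambda>A. A \<union> {w. \<exists>v\<in>A. face v w} \<union> {w. \<exists>v\<in>A. face w v})"
  have fin: "finite (N A)" if "finite A" for A
  proof -
    have "{w. \<exists>v\<in>A. face v w} = (\<Union>v\<in>A. {w. face v w})" "{w. \<exists>v\<in>A. face w v} = (\<Union>v\<in>A. {w. face w v})"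
      by auto
    then show ?thesis using that face_finite by (simp add: N_def)
  qed
  have step: "y \<in> N A" if "x \<in> A" "face x y \<or> face y x" for x y A using that unfolding N_def by blast
  have mono: "A \<subseteq> N A" for A unfolding N_def by blast
  have "set C \<subseteq> N (N (N {v}))" if "chamber C" "C ! i = v" for C
    using that(1)
  proof (rule chamberE)
    have vC: "v \<in> set C" using \<open>chamber C\<close> \<open>C ! i = v\<close> chamber_length[of C] assms nth_mem[of i C] by auto
    fix a b c d assume C: "C = [a, b, c, d]" and f: "face a b" "face b c" "face c d"
    consider "v = a" | "v = b" | "v = c" | "v = d"
      using vC by (auto simp: C)
    then show ?thesis
    proof cases
      case 1
      then have "a \<in> {v}" by simp
      then have "b \<in> N {v}" "c \<in> N (N {v})" "d \<in> N (N (N {v}))" using f step by blast+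
      then show ?thesis using mono \<open>a \<in> {v}\<close> unfolding C by auto
    next
      case 2
      then have "b \<in> {v}" by simp
      then have "a \<in> N {v}" "c \<in> N {v}" "d \<in> N (N {v})" using f step by blast+
      then show ?thesis using mono \<open>b \<in> {v}\<close> unfolding C by auto
    next
      case 3
      then have "c \<in> {v}" by simp
      then have "b \<in> N {v}" "d \<in> N {v}" "a \<in> N (N {v})" using f step by blast+
      then show ?thesis using mono \<open>c \<in> {v}\<close> unfolding C by auto
    next
      case 4
      then have "d \<in> {v}" by simp
      then have "c \<in> N {v}" "b \<in> N (N {v})" "a \<in> N (N (N {v}))" using f step by blast+
      then show ?thesis using mono \<open>d \<in> {v}\<close> unfolding C by auto
    qed
  qed
  then have "{C. chamber C \<and> C ! i = v} \<subseteq> {C. set C \<subseteq> N (N (N {v})) \<and> length C = 4}"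
    using chamber_length by auto
  moreover have "finite {C. set C \<subseteq> N (N (N {v})) \<and> length C = 4}"
    by (intro finite_lists_length_eq fin) auto
  ultimately show ?thesis by (rule finite_subset)
qed

lemma finite_box: "finite box" by (simp add: box_def)

lemma finite_rainbows_at:
  assumes "i < 4" shows "finite (rainbows_at i h)"
proof -
  have "rainbows_at i h \<subseteq> (\<Union>v\<in>box. {C. chamber C \<and> C ! i = v})" by (auto simp: rainbows_at_def)
  then show ?thesis using finite_subset finite_star[OF assms] finite_box by blast
qed

lemma odds_rep: "odds (rep v) = odds v"
  by (simp add: rep_def odds_act)

lemma odds_less: "odds v < 4"
  by (cases v) (simp add: odds_def)

text \<open>
  Count orbits of rainbow chambers by their vertex of the same dimension as \<open>v\<close>. A chamber has no two
  vertices in one orbit, because their dimensions differ. Hence only chambers with that vertex at \<open>v\<close> itself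
  notice the change, and in these only the label of \<open>v\<close> changes; their opposite facets form the closed surface to
  which \<open>link_parity\<close> applies.
\<close>
lemma parity_rainbows_upd:
  assumes v: "v \<in> box" and k: "h v \<in> {0..<4}" "k \<in> {0..<4}"
  shows "even (card (rainbows_at 0 (h(v := k)))) \<longleftrightarrow> even (card (rainbows_at 0 h))"
proof -
  define i where "i = odds v"
  have i: "i < 4" by (simp add: i_def odds_less)
  (* The three other positions in a chamber, which are the corners of a triangle in the link of v. *)
  obtain j1 j2 j3 where j: "{i, j1, j2, j3} = {0, 1, 2, 3}" "i \<noteq> j1" "i \<noteq> j2" "i \<noteq> j3"
    "j1 \<noteq> j2" "j1 \<noteq> j3" "j2 \<noteq> j3" "j1 < 4" "j2 < 4" "j3 < 4"
  proof -
    consider "i = 0" | "i = 1" | "i = 2" | "i = 3" using i by linarith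
    then show ?thesis
    proof cases
      case 1 then show ?thesis using that[of 1 2 3] by simp
    next
      case 2 then show ?thesis using that[of 0 2 3] by (simp add: insert_commute)
    next
      case 3 then show ?thesis using that[of 0 1 3] by (simp add: insert_commute)
    next
      case 4 then show ?thesis using that[of 0 1 2] by (simp add: insert_commute)
    qed
  qed
  define S where "S = {C. chamber C \<and> C ! i = v}"
  define lb where "lb = (\<lambda>j C. extend h (C ! j))"
  have finS: "finite S" unfolding S_def by (rule finite_star[OF i])
  have setC: "set C = {C ! i, C ! j1, C ! j2, C ! j3}" if "chamber C" for C
  proof -
    have "set C = (\<lambda>m. C ! m) ` {0, 1, 2, 3}"
      using that by (rule chamberE) auto
    then show ?thesis unfolding j(1)[symmetric] image_insert image_empty .
  qed
  have ext_other: "extend (h(v := k)) w = extend h w" if "rep w \<noteq> v" for w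
    using that by (simp add: extend_def)
  have ext_v: "extend g v = g v" if "g v \<in> {0..<4}" for g
    using that v by (simp add: extend_def rep_box tile_box lab_zero del: lab.simps)
  have ne: "rep (C ! j) \<noteq> v" if "chamber C" "j < 4" "j \<noteq> i" for C j
    using chamber_odds[OF that(1,2)] odds_rep[of "C ! j"] that(3) by (auto simp: i_def)
  have split: "card (rainbows_at i g) = card {C \<in> rainbows_at i g. C ! i \<noteq> v} + card {C \<in> rainbows_at i g. C ! i = v}" for g
  proof -
    have "card ({C \<in> rainbows_at i g. C ! i \<noteq> v} \<union> {C \<in> rainbows_at i g. C ! i = v})
        = card {C \<in> rainbows_at i g. C ! i \<noteq> v} + card {C \<in> rainbows_at i g. C ! i = v}"
      using finite_rainbows_at[OF i, of g] by (intro card_Un_disjoint) auto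
    moreover have "{C \<in> rainbows_at i g. C ! i \<noteq> v} \<union> {C \<in> rainbows_at i g. C ! i = v} = rainbows_at i g"
      by blast
    ultimately show ?thesis by simp
  qed
  have away: "{C \<in> rainbows_at i (h(v := k)). C ! i \<noteq> v} = {C \<in> rainbows_at i h. C ! i \<noteq> v}"
  proof -
    have "rainbow (h(v := k)) C \<longleftrightarrow> rainbow h C" if C: "chamber C" "C ! i \<in> box" "C ! i \<noteq> v" for C
    proof -
      have "extend (h(v := k)) w = extend h w" if "w \<in> set C" for w
      proof (rule ext_other)
        have "w = C ! i \<or> w = C ! j1 \<or> w = C ! j2 \<or> w = C ! j3"
          using that setC[OF C(1)] by simp
        then show "rep w \<noteq> v"
          using ne[OF C(1) j(8) j(2)[symmetric]] ne[OF C(1) j(9) j(3)[symmetric]]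
            ne[OF C(1) j(10) j(4)[symmetric]] C(3) rep_box[OF C(2)] by auto
      qed
      then have "extend (h(v := k)) ` set C = extend h ` set C" by (rule image_cong[OF refl])
      then show ?thesis by (simp add: rainbow_def)
    qed
    then show ?thesis by (auto simp: rainbows_at_def)
  qed
  have star: "{C \<in> rainbows_at i g. C ! i = v} = {C \<in> S. insert (g v) {lb j1 C, lb j2 C, lb j3 C} = {0..<4}}"
    if g: "g v \<in> {0..<4}" "\<And>w. rep w \<noteq> v \<Longrightarrow> extend g w = extend h w" for g
  proof -
    have "extend g ` set C = insert (g v) {lb j1 C, lb j2 C, lb j3 C}" if "chamber C" "C ! i = v" for C
    proof -
      have "extend g (C ! m) = lb m C" if "m < 4" "m \<noteq> i" for m
        unfolding lb_def using that ne[OF \<open>chamber C\<close>] by (intro g(2))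
      from this[OF j(8) j(2)[symmetric]] this[OF j(9) j(3)[symmetric]] this[OF j(10) j(4)[symmetric]]
      show ?thesis unfolding setC[OF \<open>chamber C\<close>] \<open>C ! i = v\<close> by (simp add: ext_v[of g, OF g(1)])
    qed
    then have "rainbow g C \<longleftrightarrow> insert (g v) {lb j1 C, lb j2 C, lb j3 C} = {0..<4}" if "C \<in> S" for C
      using that by (simp add: S_def rainbow_def)
    moreover have "{C \<in> rainbows_at i g. C ! i = v} = {C \<in> S. rainbow g C}"
      using v by (auto simp: rainbows_at_def S_def)
    ultimately show ?thesis by blast
  qed
  have "even (card {C \<in> S. insert (h v) {lb j1 C, lb j2 C, lb j3 C} = {0..<4}})
     \<longleftrightarrow> even (card {C \<in> S. insert k {lb j1 C, lb j2 C, lb j3 C} = {0..<4}})"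
  proof (rule link_parity[where t = "\<lambda>m. flip (if m = 1 then j1 else if m = 2 then j2 else j3)"])
    show "{lb j1 C, lb j2 C, lb j3 C} \<subseteq> {0..<4}" for C
      using extend_range by (auto simp: lb_def)
    show "k \<in> {0..<4}" "h v \<in> {0..<4}" by (fact k)+
    show "finite S" by (fact finS)
  next
    fix m C assume "m \<in> {1, 2, 3::nat}" "C \<in> S"
    let ?j = "if m = 1 then j1 else if m = 2 then j2 else j3"
    have "?j < 4" "?j \<noteq> i" using j by auto
    then have "flip ?j C ! i = C ! i" using \<open>C \<in> S\<close> i by (intro flip_other) (auto simp: S_def)
    then show "flip ?j C \<in> S \<and> flip ?j (flip ?j C) = C \<and> flip ?j C \<noteq> C"
      using \<open>C \<in> S\<close> flip_chamber flip_flip flip_neq unfolding S_def by blast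
  next
    have fl: "lb m' (flip m C) = lb m' C" if "C \<in> S" "m < 4" "m' < 4" "m \<noteq> m'" for C m m'
      using flip_other[of C m' m] that by (auto simp: lb_def S_def)
    fix m :: nat and C assume C: "C \<in> S"
    let ?j = "if m = 1 then j1 else if m = 2 then j2 else j3"
    show "m \<in> {2, 3::nat} \<Longrightarrow> lb j1 (flip ?j C) = lb j1 C"
      using fl[OF C] j(5-10) by auto
    show "m \<in> {1, 3::nat} \<Longrightarrow> lb j2 (flip ?j C) = lb j2 C"
      using fl[OF C] j(5-10) by auto
    show "m \<in> {1, 2::nat} \<Longrightarrow> lb j3 (flip ?j C) = lb j3 C"
      using fl[OF C] j(5-10) by auto
  qed simp
  moreover have "{C \<in> rainbows_at i (h(v := k)). C ! i = v} = {C \<in> S. insert k {lb j1 C, lb j2 C, lb j3 C} = {0..<4}}"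
    using star[of "h(v := k)"] k ext_other by simp
  moreover have "{C \<in> rainbows_at i h. C ! i = v} = {C \<in> S. insert (h v) {lb j1 C, lb j2 C, lb j3 C} = {0..<4}}"
    using star[of h] k by simp
  ultimately have "even (card (rainbows_at i (h(v := k)))) \<longleftrightarrow> even (card (rainbows_at i h))"
    unfolding split[of h] split[of "h(v := k)"] away by simp
  then show ?thesis using card_rainbows_at[of 0 i] i by simp
qed

lemma parity_rainbows_independent:
  assumes h: "\<And>v. h v \<in> {0..<4}"
  shows "even (card (rainbows_at 0 h)) \<longleftrightarrow> even (card (rainbows_at 0 (\<lambda>_. 0)))"
proof -
  have "even (card (rainbows_at 0 (\<lambda>v. if v \<in> A then h v else 0))) \<longleftrightarrow> even (card (rainbows_at 0 (\<lambda>_. 0)))"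
    if "finite A" "A \<subseteq> box" for A
    using that
  proof (induction A rule: finite_induct)
    case (insert v A)
    have "(\<lambda>w. if w \<in> insert v A then h w else 0) = (\<lambda>w. if w \<in> A then h w else 0)(v := h v)"
      by auto
    then show ?case using insert parity_rainbows_upd[of v "\<lambda>w. if w \<in> A then h w else 0" "h v"] h[of v]
      by auto
  qed simp
  from this[OF finite_box subset_refl]
  moreover have "extend (\<lambda>v. if v \<in> box then h v else 0) = extend h"
    by (auto simp: extend_def rep_in_box)
  ultimately show ?thesis by (simp add: rainbows_at_def rainbow_def)
qed

section \<open>The labelling that vanishes on the box\<close>

text \<open>
  Only the box and the layer of points one unit outside its lower faces matter for chambers that start in
  the box: their first vertex has even coordinates, hence lies at least two units below the even numbers
  \<open>2 * n\<close> and \<open>n\<close>.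
\<close>
lemma extend_zero:
  assumes "-1 \<le> x" "x < 2 * n" "-1 \<le> y" "y < 2 * n" "-1 \<le> z" "z < n"
  shows "extend (\<lambda>_. 0) (x, y, z) =
    (if x \<ge> 0 then (if y \<ge> 0 then (if z \<ge> 0 then 0 else 1) else (if z \<ge> 1 then 2 else 3))
     else (if y \<le> 0 then (if z \<ge> 0 then 2 else 3) else (if z \<ge> 1 then 0 else 1)))"
proof -
  define p where "p = (if x \<ge> 0 then 0 else (-1::int))"
  define q where "q = (if x \<ge> 0 then (if y \<ge> 0 then 0 else -1) else (if y \<le> 0 then 0 else (1::int)))"
  define r where "r = (if q = 0 then (if z \<ge> 0 then 0 else -1) else (if z \<le> 0 then 0 else (1::int)))"
  have n: "2 \<le> n" using n_pos n_even by presburger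
  have div: "u div m = (if u \<ge> 0 then 0 else -1)" if "-m \<le> u" "u < m" for u m :: int
    using that by (auto simp: int_div_pos_eq[of u m "-1" "u + m"])
  have p: "x div (2 * n) = p" using assms n by (subst div) (auto simp: p_def)
  have q: "sg p * (sg p * y div (2 * n)) = q"
    using assms n by (subst div) (auto simp: p_def q_def sg_def)
  have r: "sg q * (sg q * z div n) = r"
    using assms n by (subst div) (auto simp: r_def q_def sg_def)
  have "tile (x, y, z) = (p, q, r)" unfolding tile.simps Let_def p q r ..
  then show ?thesis
    by (simp add: extend_def) (simp add: p_def q_def r_def sg_def)
qed

text \<open>
  Labels other than 0 occur only where a coordinate is negative, so a rainbow chamber starting in the box
  leaves it through the lower faces. Of all ways of leaving only one, at the common corner of these faces,
  collects all labels.
\<close>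
lemma rainbows_at_zero: "rainbows_at 0 (\<lambda>_. 0) = {[(0, 0, 0), (-1, 0, 0), (-1, 0, -1), (-1, 1, -1)]}"
proof
  have n: "2 \<le> n" using n_pos n_even by presburger
  show "{[(0, 0, 0), (-1, 0, 0), (-1, 0, -1), (-1, 1, -1)]} \<subseteq> rainbows_at 0 (\<lambda>_. 0)"
    using n by (auto simp: rainbows_at_def rainbow_def extend_zero odds_def face_def face1_def box_def)
  show "rainbows_at 0 (\<lambda>_. 0) \<subseteq> {[(0, 0, 0), (-1, 0, 0), (-1, 0, -1), (-1, 1, -1)]}"
  proof
    fix C assume "C \<in> rainbows_at 0 (\<lambda>_. 0)"
    then have C: "chamber C" "rainbow (\<lambda>_. 0) C" "C ! 0 \<in> box" by (auto simp: rainbows_at_def)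
    then obtain x0 y0 z0 x1 y1 z1 x2 y2 z2 x3 y3 z3 where
      Ceq: "C = [(x0, y0, z0), (x1, y1, z1), (x2, y2, z2), (x3, y3, z3)]"
      by (metis chamberE prod.exhaust)
    have ev: "even x0" "even y0" "even z0" "odd x3" "odd y3" "odd z3"
      using C(1) by (auto simp: Ceq odds_def of_bool_def split: if_splits)
    have od: "odds (x1, y1, z1) = 1" "odds (x2, y2, z2) = 2"
      using C(1) by (auto simp: Ceq)
    have f: "face1 x0 x1" "face1 x1 x2" "face1 x2 x3" "face1 y0 y1" "face1 y1 y2" "face1 y2 y3"
        "face1 z0 z1" "face1 z1 z2" "face1 z2 z3"
      using C(1) by (auto simp: Ceq face_def)
    have b: "0 \<le> x0" "x0 < 2 * n" "0 \<le> y0" "y0 < 2 * n" "0 \<le> z0" "z0 < n"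
      using C(3) by (auto simp: Ceq box_def)
    (* Each coordinate moves exactly once along a chamber, from an even to an odd value. *)
    have steps: "u1 = u0 \<and> u2 = u0 \<and> even u1 \<and> even u2 \<or> u1 = u0 \<and> u2 = u3 \<and> even u1 \<and> odd u2
        \<or> u1 = u3 \<and> u2 = u3 \<and> odd u1 \<and> odd u2"
      if "face1 u0 u1" "face1 u1 u2" "face1 u2 u3" "even u0" "odd u3" for u0 u1 u2 u3
    proof -
      have *: "v = u \<or> even u \<and> odd v" if "face1 u v" for u v
        using that unfolding face1_def by auto
      show ?thesis using *[OF that(1)] *[OF that(2)] *[OF that(3)] that(4,5) by blast
    qed
    (* Only the positions relative to 0 matter: a coordinate starting at 0 may leave the box, all others stay positive. *)
    have move: "u0 = 0 \<and> u3 = -1 \<or> u0 = 0 \<and> u3 = 1 \<or> 0 < u0 \<and> 0 < u3 \<and> u3 < 2 * m"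
      if "face1 u0 u1" "face1 u1 u2" "face1 u2 u3" "even u0" "odd u3" "0 \<le> u0" "u0 < 2 * m" for u0 u1 u2 u3 m
    proof -
      have "u3 = u0 + 1 \<or> u3 = u0 - 1" using that unfolding face1_def by auto
      then show ?thesis using that(4-7) by presburger
    qed
    obtain m where m: "n = 2 * m" using n_even by blast
    note mx = move[OF f(1-3) ev(1,4) b(1,2)] and my = move[OF f(4-6) ev(2,5) b(3,4)]
      and mz = move[OF f(7-9) ev(3,6) b(5) b(6)[unfolded m], folded m]
    let ?e = "\<lambda>(x, y, z). if x \<ge> 0 then (if y \<ge> 0 then (if z \<ge> 0 then 0 else 1) else (if z \<ge> 1 then 2 else 3))
     else (if y \<le> 0 then (if z \<ge> 0 then 2 else 3) else (if z \<ge> 1 then 0 else (1::int)))"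
    have bd: "-1 \<le> x3" "x3 < 2 * n" "-1 \<le> y3" "y3 < 2 * n" "-1 \<le> z3" "z3 < n"
      using mx my mz n by linarith+
    define P where "P = {(x, y, z). x \<in> {x0, x3} \<and> y \<in> {y0, y3} \<and> z \<in> {z0, z3}}"
    have ext: "extend (\<lambda>_. 0) v = ?e v" if "v \<in> P" for v
    proof -
      obtain x y z where v: "v = (x, y, z)" by (metis prod.exhaust)
      have "x = x0 \<or> x = x3" "y = y0 \<or> y = y3" "z = z0 \<or> z = z3" using that by (auto simp: P_def v)
      then have "-1 \<le> x" "x < 2 * n" "-1 \<le> y" "y < 2 * n" "-1 \<le> z" "z < n"
        using bd b n by linarith+
      then show ?thesis unfolding v by (subst extend_zero) auto
    qed
    (* The order in which the three coordinates move. *)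
    have perm: "(x1, y1, z1, x2, y2, z2) \<in> {(x3, y0, z0, x3, y3, z0), (x3, y0, z0, x3, y0, z3),
        (x0, y3, z0, x3, y3, z0), (x0, y3, z0, x0, y3, z3), (x0, y0, z3, x3, y0, z3), (x0, y0, z3, x0, y3, z3)}"
      using steps[OF f(1-3) ev(1,4)] steps[OF f(4-6) ev(2,5)] steps[OF f(7-9) ev(3,6)] od
      by (elim disjE conjE) (simp_all add: odds_def)
    then have "set C \<subseteq> P" unfolding Ceq P_def by auto
    then have "extend (\<lambda>_. 0) ` set C = ?e ` set C"
      by (intro image_cong[OF refl] ext) blast
    then have "?e ` set C = {0..<4}"
      using C(2) unfolding rainbow_def by simp
    then have "{0, 1, 2, 3} \<subseteq> ?e ` set C" by auto
    then have R: "0 \<in> ?e ` set C" "1 \<in> ?e ` set C" "2 \<in> ?e ` set C" "3 \<in> ?e ` set C" by simp_all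
    (* Six orders of moves and at most three positions per coordinate leave a finite check. *)
    show "C \<in> {[(0, 0, 0), (-1, 0, 0), (-1, 0, -1), (-1, 1, -1)]}"
      using perm mx my mz R unfolding Ceq
      by (simp only: insert_iff empty_iff prod.inject simp_thms) (elim disjE conjE; simp)
  qed
qed

lemma exists_rainbow:
  assumes "\<And>v. h v \<in> {0..<4}"
  obtains C where "chamber C" "rainbow h C" "C ! 0 \<in> box"
proof -
  have "odd (card (rainbows_at 0 h))" using parity_rainbows_independent[of h] assms rainbows_at_zero by simp
  then have "rainbows_at 0 h \<noteq> {}" by auto
  then show ?thesis using that by (auto simp: rainbows_at_def)
qed

end

section \<open>Euler angles and the diagonals of a cube\<close>

definition rotz :: "real \<Rightarrow> real^3^3" where
  "rotz t = vector [vector [cos t, - sin t, 0], vector [sin t, cos t, 0], vector [0, 0, 1]]"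

definition roty :: "real \<Rightarrow> real^3^3" where
  "roty t = vector [vector [cos t, 0, sin t], vector [0, 1, 0], vector [- sin t, 0, cos t]]"

definition euler :: "real \<times> real \<times> real \<Rightarrow> real^3^3" where
  "euler P = (case P of (a, b, c) \<Rightarrow> rotz a ** (roty b ** rotz c))"

text \<open>
  A vertex of the reference cube, whose edges are parallel to the axes. Its images under quarter turns about the
  third axis represent all four diagonals.
\<close>
definition diag :: "real^3" where
  "diag = vector [1 / sqrt 3, 1 / sqrt 3, 1 / sqrt 3]"

lemmas matrix_entries = vec_eq_iff forall_3 matrix_matrix_mult_def matrix_vector_mult_def sum_3 transpose_def mat_def

lemma rotz_add: "rotz s ** rotz t = rotz (s + t)"
  by (simp add: matrix_entries rotz_def cos_add sin_add algebra_simps)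

lemma roty_add: "roty s ** roty t = roty (s + t)"
  by (simp add: matrix_entries roty_def cos_add sin_add algebra_simps)

lemma roty_rotz_pi: "rotz pi ** roty (- t) = roty t ** rotz pi"
  by (simp add: matrix_entries rotz_def roty_def)

lemma rotz_roty_pi: "roty pi ** rotz (- t) = rotz t ** roty pi"
  by (simp add: matrix_entries rotz_def roty_def)

lemma roty_pi_diag: "roty pi *v diag = - (rotz (- (pi / 2)) *v diag)"
  by (simp add: matrix_entries rotz_def roty_def diag_def)

lemma rotation_rotz: "rotation_matrix (rotz t)"
  unfolding rotation_matrix_def orthogonal_matrix
  by (simp add: matrix_entries rotz_def det_3 power2_eq_square[symmetric])

lemma rotation_roty: "rotation_matrix (roty t)"
  unfolding rotation_matrix_def orthogonal_matrix
  by (simp add: matrix_entries roty_def det_3 power2_eq_square[symmetric])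

lemma rotation_mult: "rotation_matrix A \<Longrightarrow> rotation_matrix B \<Longrightarrow> rotation_matrix (A ** B :: real^3^3)"
  by (simp add: rotation_matrix_def orthogonal_matrix_mul det_mul)

lemma rotation_euler: "rotation_matrix (euler P)"
  by (cases P) (simp add: euler_def rotation_mult rotation_rotz rotation_roty)

lemma norm_diag: "norm diag = 1"
  by (simp add: norm_vec_def L2_set_def sum_3 diag_def power_divide)

lemma norm_orthogonal:
  assumes "orthogonal_matrix (A :: real^3^3)" shows "norm (A *v x) = norm x"
proof -
  have "orthogonal_transformation ((*v) A)"
    using assms by (simp add: orthogonal_transformation_matrix)
  then show ?thesis by (rule orthogonal_transformation_norm)
qed

lemma norm_euler: "norm (euler P *v diag) = 1"
  using rotation_euler[of P] by (simp add: norm_orthogonal rotation_matrix_def norm_diag)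

lemma cos_sin_shift:
  fixes p :: int
  shows "cos (t + p * pi) = (if even p then cos t else - cos t)" "sin (t + p * pi) = (if even p then sin t else - sin t)"
  by (auto simp: cos_add sin_add cos_npi_int sin_npi_int mult.commute[of _ pi])

lemma rotz_shift: "rotz (t + real_of_int p * pi) = (if even p then rotz t else rotz (t + pi))"
  by (simp add: rotz_def cos_sin_shift)

lemma roty_shift: "roty (t + real_of_int p * pi) = (if even p then roty t else roty (t + pi))"
  by (simp add: roty_def cos_sin_shift)

lemma euler_add: "euler (a, b, c + d) *v x = euler (a, b, c) *v (rotz d *v x)"
  by (simp add: euler_def matrix_vector_mul_assoc matrix_mul_assoc[symmetric] rotz_add)

text \<open>
  The ambiguity of Euler angles: a half turn in the outer rotations is compensated by
  reversing the middle one.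
\<close>
lemma euler_half_turns_outer:
  "euler (a + real_of_int p * pi, (if even p then b else - b), c + real_of_int p * pi) = euler (a, b, c)"
proof (cases "even p")
  case False
  have "rotz (a + pi) ** (roty (- b) ** rotz (c + pi)) = rotz a ** ((rotz pi ** roty (- b)) ** rotz (c + pi))"
    by (simp add: matrix_mul_assoc rotz_add)
  also have "\<dots> = rotz a ** (roty b ** (rotz pi ** rotz (c + pi)))"
    by (simp add: roty_rotz_pi matrix_mul_assoc)
  also have "rotz pi ** rotz (c + pi) = rotz c"
    unfolding rotz_add by (simp add: rotz_def cos_add sin_add)
  finally show ?thesis using False by (simp add: euler_def rotz_shift)
qed (simp add: euler_def rotz_shift)

lemma matrix_vector_mult_minus: "A *v (- x) = - (A *v x)" for A :: "real^'n^'m"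
  by (rule linear_neg) simp

text \<open>
  A half turn in the middle rotation reverses the inner one and then acts on the cube itself, where it sends
  \<open>diag\<close> to the antipode of an adjacent vertex.
\<close>
lemma euler_half_turns_middle:
  "euler (a, b + real_of_int q * pi, (if even q then c else - c - pi / 2)) *v diag
    = (if even q then euler (a, b, c) *v diag else - (euler (a, b, c) *v diag))"
proof (cases "even q")
  case False
  have "roty (b + pi) ** rotz (- c - pi / 2) *v diag = roty b ** (roty pi ** rotz (- (c + pi / 2))) *v diag"
    by (simp add: matrix_mul_assoc roty_add)
  also have "\<dots> = (roty b ** rotz (c + pi / 2)) *v (roty pi *v diag)"
    unfolding rotz_roty_pi by (simp add: matrix_vector_mul_assoc matrix_mul_assoc)
  also have "\<dots> = - ((roty b ** (rotz (c + pi / 2) ** rotz (- (pi / 2)))) *v diag)"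
    unfolding roty_pi_diag by (simp add: matrix_vector_mul_assoc matrix_mul_assoc matrix_vector_mult_minus)
  also have "rotz (c + pi / 2) ** rotz (- (pi / 2)) = rotz c" by (simp add: rotz_add)
  finally show ?thesis
    using False by (simp add: euler_def roty_shift matrix_vector_mul_assoc[symmetric] matrix_vector_mult_minus)
qed (simp add: euler_def roty_shift)

lemma euler_diag_components:
  fixes a b c :: real
  defines "u \<equiv> cos b * (cos c - sin c) + sin b" and "w \<equiv> sin c + cos c"
  shows "(euler (a, b, c) *v diag) $ 1 = (cos a * u - sin a * w) / sqrt 3"
    and "(euler (a, b, c) *v diag) $ 2 = (sin a * u + cos a * w) / sqrt 3"
    and "(euler (a, b, c) *v diag) $ 3 = (cos b - sin b * (cos c - sin c)) / sqrt 3"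
proof -
  have 1: "rotz c *v diag = (1 / sqrt 3) *\<^sub>R vector [cos c - sin c, w, 1]"
    by (simp add: vec_eq_iff forall_3 matrix_vector_mult_def sum_3 rotz_def diag_def w_def field_simps)
  have 2: "roty b *v vector [cos c - sin c, w, 1] = vector [u, w, cos b - sin b * (cos c - sin c)]"
    by (simp add: vec_eq_iff forall_3 matrix_vector_mult_def sum_3 roty_def u_def algebra_simps)
  have "euler (a, b, c) *v diag = rotz a *v (roty b *v (rotz c *v diag))"
    by (simp add: euler_def matrix_vector_mul_assoc)
  then have eq: "euler (a, b, c) *v diag
      = (1 / sqrt 3) *\<^sub>R (rotz a *v vector [u, w, cos b - sin b * (cos c - sin c)])"
    by (simp only: 1 2 matrix_vector_mult_scaleR)
  show "(euler (a, b, c) *v diag) $ 1 = (cos a * u - sin a * w) / sqrt 3"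
    "(euler (a, b, c) *v diag) $ 2 = (sin a * u + cos a * w) / sqrt 3"
    "(euler (a, b, c) *v diag) $ 3 = (cos b - sin b * (cos c - sin c)) / sqrt 3"
    unfolding eq by (simp_all add: matrix_vector_mult_def sum_3 rotz_def)
qed

lemma continuous_euler: "continuous_on UNIV (\<lambda>P. euler P *v diag)"
proof -
  have "\<forall>i. continuous_on UNIV (\<lambda>P. (euler P *v diag) $ i)"
  proof -
    have "continuous_on UNIV (\<lambda>P. (euler (fst P, fst (snd P), snd (snd P)) *v diag) $ 1)"
      "continuous_on UNIV (\<lambda>P. (euler (fst P, fst (snd P), snd (snd P)) *v diag) $ 2)"
      "continuous_on UNIV (\<lambda>P. (euler (fst P, fst (snd P), snd (snd P)) *v diag) $ 3)"
      unfolding euler_diag_components by (intro continuous_intros; simp)+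
    then show ?thesis unfolding forall_3 by simp
  qed
  then have "continuous_on UNIV (\<lambda>P. \<chi> i. (euler P *v diag) $ i)"
    by (intro continuous_on_vec_lambda) blast
  then show ?thesis by simp
qed

lemma corner_eq_rotz_diag:
  fixes x :: "real^3"
  assumes "\<forall>i. x $ i = 1 \<or> x $ i = -1"
  obtains k :: int and s :: real where "k \<in> {0..<4}" "s = 1 \<or> s = -1"
    "x = (s * sqrt 3) *\<^sub>R (rotz (k * pi / 2) *v diag)"
proof -
  have x: "x $ 1 = 1 \<or> x $ 1 = -1" "x $ 2 = 1 \<or> x $ 2 = -1" "x $ 3 = 1 \<or> x $ 3 = -1"
    using assms by blast+
  have r: "sqrt 3 *\<^sub>R (rotz (real_of_int 0 * pi / 2) *v diag) = vector [1, 1, 1]"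
      "sqrt 3 *\<^sub>R (rotz (real_of_int 1 * pi / 2) *v diag) = vector [-1, 1, 1]"
      "sqrt 3 *\<^sub>R (rotz (real_of_int 2 * pi / 2) *v diag) = vector [-1, -1, 1]"
      "sqrt 3 *\<^sub>R (rotz (real_of_int 3 * pi / 2) *v diag) = vector [1, -1, 1]"
  proof -
    have [simp]: "cos (3 * pi / 2) = 0" "sin (3 * pi / 2) = -1"
      using cos_3over2_pi sin_3over2_pi by (simp_all add: field_simps)
    show "sqrt 3 *\<^sub>R (rotz (real_of_int 0 * pi / 2) *v diag) = vector [1, 1, 1]"
      "sqrt 3 *\<^sub>R (rotz (real_of_int 1 * pi / 2) *v diag) = vector [-1, 1, 1]"
      "sqrt 3 *\<^sub>R (rotz (real_of_int 2 * pi / 2) *v diag) = vector [-1, -1, 1]"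
      "sqrt 3 *\<^sub>R (rotz (real_of_int 3 * pi / 2) *v diag) = vector [1, -1, 1]"
      by (simp_all add: matrix_entries rotz_def diag_def)
  qed
  have "\<exists>k\<in>{0, 1, 2, 3 :: int}. x = (x $ 3) *\<^sub>R (sqrt 3 *\<^sub>R (rotz (real_of_int k * pi / 2) *v diag))"
  proof -
    have e: "x = (x $ 3) *\<^sub>R vector [p, q, 1]" if "x $ 1 = x $ 3 * p" "x $ 2 = x $ 3 * q" for p q
      using that unfolding vec_eq_iff forall_3 by simp
    have "(x $ 1 = x $ 3 * 1 \<or> x $ 1 = x $ 3 * (-1)) \<and> (x $ 2 = x $ 3 * 1 \<or> x $ 2 = x $ 3 * (-1))"
      using x by (elim disjE) simp_all
    then have "x = (x $ 3) *\<^sub>R vector [1, 1, 1] \<or> x = (x $ 3) *\<^sub>R vector [-1, 1, 1] \<or>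
        x = (x $ 3) *\<^sub>R vector [-1, -1, 1] \<or> x = (x $ 3) *\<^sub>R vector [1, -1, 1]"
      using e by blast
    then show ?thesis unfolding r[symmetric] by blast
  qed
  then obtain k where "k \<in> {0, 1, 2, 3 :: int}" "x = (x $ 3) *\<^sub>R (sqrt 3 *\<^sub>R (rotz (real_of_int k * pi / 2) *v diag))"
    by blast
  then show ?thesis using that[of k "x $ 3"] x(3) by auto
qed

text \<open>
  Since \<open>c + r *\<^sub>R (Q *v x)\<close> and \<open>c - r *\<^sub>R (Q *v x)\<close> are both of norm 1, the centre \<open>c\<close> is orthogonal to all vertices and
  vanishes. If \<open>Q\<close> reverses orientation then \<open>-Q\<close> does not, because the dimension is odd, and the sign is
  irrelevant for diagonals.
\<close>
lemma inscribed_cube_onto_reference: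
  assumes "is_cube_vertex_set V" "V \<subseteq> sphere 0 1"
  obtains A :: "real^3^3" where "rotation_matrix A"
    "\<And>v. v \<in> V \<Longrightarrow> \<exists>k\<in>{0..<4::int}. A *v v = rotz (k * pi / 2) *v diag \<or> A *v v = - (rotz (k * pi / 2) *v diag)"
proof -
  obtain c r and Q :: "real^3^3" where Q: "r > 0" "orthogonal_matrix Q"
    and V: "V = (\<lambda>x. c + r *\<^sub>R (Q *v x)) ` {x. \<forall>i. x $ i = 1 \<or> x $ i = -1}"
    using assms(1) unfolding is_cube_vertex_set_def by blast
  have n: "norm (c + r *\<^sub>R (Q *v x)) = 1" if "\<forall>i. x $ i = 1 \<or> x $ i = -1" for x
  proof -
    have "c + r *\<^sub>R (Q *v x) \<in> sphere 0 1" using assms(2) that unfolding V by blast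
    then show ?thesis by simp
  qed
  have perp: "c \<bullet> (Q *v x) = 0" if x: "\<forall>i. x $ i = 1 \<or> x $ i = -1" for x
  proof -
    have x': "\<forall>i. (- x) $ i = 1 \<or> (- x) $ i = -1"
    proof
      show "(- x) $ i = 1 \<or> (- x) $ i = -1" for i using spec[OF x, of i] by auto
    qed
    have "norm (c + r *\<^sub>R (Q *v x)) = norm (c + r *\<^sub>R (Q *v (- x)))"
      using n[OF x] n[OF x'] by simp
    then have "(c + r *\<^sub>R (Q *v x)) \<bullet> (c + r *\<^sub>R (Q *v x)) = (c - r *\<^sub>R (Q *v x)) \<bullet> (c - r *\<^sub>R (Q *v x))"
      by (simp add: norm_eq matrix_vector_mult_minus)
    then show ?thesis using Q(1) by (simp add: algebra_simps inner_commute)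
  qed
  define w where "w = transpose Q *v c"
  have "w \<bullet> x = 0" if "\<forall>i. x $ i = 1 \<or> x $ i = -1" for x
    using perp[OF that] by (simp add: w_def dot_lmul_matrix[symmetric] vector_transpose_matrix inner_commute)
  from this[of "vector [1, 1, 1]"] this[of "vector [-1, 1, 1]"] this[of "vector [1, -1, 1]"] this[of "vector [1, 1, -1]"]
  have "w = 0" by (simp add: forall_3 inner_vec_def sum_3 vec_eq_iff)
  have "c = (Q ** transpose Q) *v c" using Q(2) by (simp add: orthogonal_matrix_def)
  also have "\<dots> = Q *v w" by (simp only: w_def matrix_vector_mul_assoc)
  finally have c: "c = 0" using \<open>w = 0\<close> by simp
  have r: "r * sqrt 3 = 1"
  proof -
    have "norm (vector [1, 1, 1] :: real^3) = sqrt 3" by (simp add: norm_vec_def L2_set_def sum_3)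
    then show ?thesis using n[of "vector [1, 1, 1]"] Q by (simp add: c norm_orthogonal forall_3)
  qed
  define A where "A = det Q *\<^sub>R transpose Q"
  have d: "det Q = 1 \<or> det Q = -1" using Q(2) det_orthogonal_matrix by blast
  have AQ: "A ** Q = det Q *\<^sub>R mat 1"
    using Q(2) by (simp add: A_def orthogonal_matrix_def scalar_matrix_assoc[symmetric])
  have "orthogonal_matrix A"
    using Q(2) d by (auto simp: A_def orthogonal_matrix_def scalar_matrix_assoc[symmetric] matrix_scalar_ac transpose_scalar)
  moreover have "det A = det Q ^ 3 * det (transpose Q)"
    unfolding A_def det_3[of "_ *\<^sub>R _"] det_3[of "transpose Q"] by (simp add: power3_eq_cube algebra_simps)
  then have "det A = 1" using d by auto
  ultimately  have "rotation_matrix A" by (simp add: rotation_matrix_def)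
  moreover have "\<exists>k\<in>{0..<4::int}. A *v v = rotz (k * pi / 2) *v diag \<or> A *v v = - (rotz (k * pi / 2) *v diag)"
    if "v \<in> V" for v
  proof -
    from that[unfolded V] obtain x where x: "v = c + r *\<^sub>R (Q *v x)" "\<forall>i. x $ i = 1 \<or> x $ i = -1"
      by (elim imageE CollectE)
    obtain k s where k: "k \<in> {0..<4::int}" "s = 1 \<or> s = -1" "x = (s * sqrt 3) *\<^sub>R (rotz (k * pi / 2) *v diag)"
      using corner_eq_rotz_diag[OF x(2)] by blast
    have "A *v v = r *\<^sub>R ((A ** Q) *v x)"
      by (simp add: x(1) c matrix_vector_mult_scaleR matrix_vector_mul_assoc)
    also have "\<dots> = (r * det Q) *\<^sub>R x" by (simp add: AQ scaleR_matrix_vector_assoc[symmetric])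
    also have "\<dots> = ((r * sqrt 3) * (det Q * s)) *\<^sub>R (rotz (k * pi / 2) *v diag)"
      by (simp add: k(3))
    finally show ?thesis using k d unfolding r by auto
  qed
  ultimately show ?thesis using that by blast
qed

section \<open>From the grid to the sphere\<close>

context grid begin

definition angles :: "point \<Rightarrow> real \<times> real \<times> real" where
  "angles v = (case v of (x, y, z) \<Rightarrow> (x * pi / (2 * n), y * pi / (2 * n), z * pi / (2 * n)))"

end

text \<open>
  The function \<open>f\<^sub>k\<close> of the introduction in Euler angles.
\<close>
definition vertex_value :: "(real^3 \<Rightarrow> real) \<Rightarrow> int \<Rightarrow> real \<times> real \<times> real \<Rightarrow> real" where
  "vertex_value F k P = F (euler P *v (rotz (k * pi / 2) *v diag))"

lemma vertex_value_shift:
  "vertex_value F k (a, b, c) = F (euler (a, b, c + k * pi / 2) *v diag)"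
  by (simp add: vertex_value_def euler_add)

lemma rotz_mod4: "rotz (real_of_int (k mod 4) * pi / 2) = rotz (k * pi / 2)"
proof -
  have eq: "real_of_int k * pi / 2 = real_of_int (k mod 4) * pi / 2 + real_of_int (2 * (k div 4)) * pi"
  proof -
    have "real_of_int k = real_of_int (4 * (k div 4) + k mod 4)" by simp
    then show ?thesis unfolding of_int_add of_int_mult by (simp add: algebra_simps)
  qed
  show ?thesis by (simp only: eq rotz_shift) simp
qed

text \<open>
  The group was chosen for this: it permutes the four functions, by \<open>lab\<close>. The three factors of a group
  element are accounted for one at a time: the quarter turns shift the index \<open>k\<close> by definition, and the
  other two are \<open>euler_half_turns_middle\<close> and \<open>euler_half_turns_outer\<close>. Evenness of \<open>F\<close> absorbs the antipode in the
  former.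
\<close>
lemma (in grid) vertex_value_act:
  assumes even_F: "\<And>x. norm x = 1 \<Longrightarrow> F (- x) = F x"
  shows "vertex_value F (lab g k) (angles (act g v)) = vertex_value F k (angles v)"
proof -
  obtain p q r x y z where gv: "g = (p, q, r)" "v = (x, y, z)" by (metis prod.exhaust)
  define a b c where abc: "a = x * pi / (2 * n)" "b = y * pi / (2 * n)" "c = z * pi / (2 * n)"
  have n: "real_of_int n \<noteq> 0" using n_pos by simp
  define m where "m = sg q * (k + 2 * p) - (if even q then 0 else 1) - r"
  define d where "d = c + k * pi / 2 + p * pi"
  have "angles (act g v) = (a + p * pi, sg p * b + q * pi, sg q * c + r * pi / 2)"
    using n by (simp add: gv angles_def abc field_simps)
  then have "vertex_value F (lab g k) (angles (act g v))
      = vertex_value F m (a + p * pi, sg p * b + q * pi, sg q * c + r * pi / 2)"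
    by (simp add: vertex_value_def gv m_def rotz_mod4)
  also have "vertex_value F m (a + p * pi, sg p * b + q * pi, sg q * c + r * pi / 2)
      = F (euler (a + p * pi, sg p * b + q * pi, (if even q then d else - d - pi / 2)) *v diag)"
  proof -
    have "sg q * c + r * pi / 2 + m * pi / 2 = (if even q then d else - d - pi / 2)"
      by (simp add: m_def d_def sg_def field_simps)
    then show ?thesis unfolding vertex_value_shift by (simp only:)
  qed
  also have "\<dots> = F (euler (a + p * pi, sg p * b, d) *v diag)"
    unfolding euler_half_turns_middle by (simp add: even_F norm_euler)
  also have "euler (a + p * pi, sg p * b, d) = euler (a, b, c + k * pi / 2)"
  proof -
    have "sg p * b = (if even p then b else - b)" by (simp add: sg_def)
    then show ?thesis unfolding d_def by (simp only: euler_half_turns_outer)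
  qed
  also have "F (euler (a, b, c + k * pi / 2) *v diag) = vertex_value F k (angles v)"
    by (simp add: vertex_value_shift gv angles_def abc)
  finally show ?thesis .
qed

lemma continuous_vertex_value:
  assumes "continuous_on (sphere 0 1) F"
  shows "continuous_on UNIV (vertex_value F k)"
proof -
  have *: "vertex_value F k = (\<lambda>P. F (euler (fst P, fst (snd P), snd (snd P) + k * pi / 2) *v diag))"
    by (auto simp: vertex_value_shift fun_eq_iff)
  have "continuous_on UNIV (\<lambda>P. euler (fst P, fst (snd P), snd (snd P) + k * pi / 2) *v diag)"
    by (rule continuous_on_compose2[OF continuous_euler]) (auto intro!: continuous_intros)
  then show ?thesis unfolding *
    by (rule continuous_on_compose2[OF assms]) (auto simp: norm_euler)
qed

lemma (in grid) chamber_near: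
  assumes "chamber C" "v \<in> set C"
  shows "dist (angles v) (angles (C ! 0)) \<le> 9 * pi / (2 * n)"
proof -
  obtain a b c d where C: "C = [a, b, c, d]" "face a b" "face b c" "face c d"
    using assms(1) by (rule chamberE)
  obtain x y z x1 y1 z1 x2 y2 z2 x3 y3 z3 where e: "a = (x, y, z)" "b = (x1, y1, z1)"
    "c = (x2, y2, z2)" "d = (x3, y3, z3)" by (metis prod.exhaust)
  obtain x' y' z' where v: "v = (x', y', z')" by (metis prod.exhaust)
  have near: "\<bar>x1 - x\<bar> \<le> 1" "\<bar>x2 - x1\<bar> \<le> 1" "\<bar>x3 - x2\<bar> \<le> 1" "\<bar>y1 - y\<bar> \<le> 1" "\<bar>y2 - y1\<bar> \<le> 1"
    "\<bar>y3 - y2\<bar> \<le> 1" "\<bar>z1 - z\<bar> \<le> 1" "\<bar>z2 - z1\<bar> \<le> 1" "\<bar>z3 - z2\<bar> \<le> 1"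
    using C(2-4) by (simp_all add: e face_def face1_iff)
  have "v = a \<or> v = b \<or> v = c \<or> v = d" using assms(2) by (simp add: C(1))
  then have "x' = x \<or> x' = x1 \<or> x' = x2 \<or> x' = x3" "y' = y \<or> y' = y1 \<or> y' = y2 \<or> y' = y3"
    "z' = z \<or> z' = z1 \<or> z' = z2 \<or> z' = z3" by (elim disjE; simp add: v e)+
  moreover have "\<bar>u - u0\<bar> \<le> 3"
    if "u = u0 \<or> u = u1 \<or> u = u2 \<or> u = u3" "\<bar>u1 - u0\<bar> \<le> 1" "\<bar>u2 - u1\<bar> \<le> 1" "\<bar>u3 - u2\<bar> \<le> 1"
    for u u0 u1 u2 u3 :: int using that by linarith
  ultimately have "\<bar>x' - x\<bar> \<le> 3" "\<bar>y' - y\<bar> \<le> 3" "\<bar>z' - z\<bar> \<le> 3"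
    using near by blast+
  then have r: "\<bar>real_of_int x' - x\<bar> \<le> 3" "\<bar>real_of_int y' - y\<bar> \<le> 3" "\<bar>real_of_int z' - z\<bar> \<le> 3"
    by linarith+
  have n: "real_of_int n > 0" using n_pos by simp
  have s: "\<bar>real_of_int u' * pi / (2 * n) - real_of_int u * pi / (2 * n)\<bar> \<le> 3 * pi / (2 * n)"
    if "\<bar>real_of_int u' - u\<bar> \<le> 3" for u u' :: int
  proof -
    have "real_of_int u' * pi / (2 * n) - real_of_int u * pi / (2 * n) = (real_of_int u' - u) * (pi / (2 * n))"
      using n by (simp add: field_simps)
    also have "\<bar>\<dots>\<bar> = \<bar>real_of_int u' - u\<bar> * (pi / (2 * n))"
      using n by (simp add: abs_mult)
    also have "\<dots> \<le> 3 * (pi / (2 * n))" using that n by (intro mult_right_mono) auto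
    finally show ?thesis by simp
  qed
  have "dist (angles v) (angles a) = norm (angles v - angles a)" by (rule dist_norm)
  also have "\<dots> \<le> \<bar>x' * pi / (2 * n) - x * pi / (2 * n)\<bar> + (\<bar>y' * pi / (2 * n) - y * pi / (2 * n)\<bar>
      + \<bar>z' * pi / (2 * n) - z * pi / (2 * n)\<bar>)"
    unfolding angles_def e v case_prod_conv diff_Pair
    by (intro order_trans[OF norm_Pair_le] add_mono) (auto intro: order_trans[OF norm_Pair_le])
  also have "\<dots> \<le> 9 * pi / (2 * n)" using s[OF r(1)] s[OF r(2)] s[OF r(3)] by simp
  finally show ?thesis by (simp add: C)
qed

text \<open>
  Label each point by an index with the largest value; on the box the choice is arbitrary, and by
  \<open>vertex_value_act\<close> its compatible extension still picks an index with the largest value everywhere. The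
  point \<open>P\<close> is a vertex of a rainbow chamber, and the points \<open>Q\<close> are its vertices with label \<open>k\<close>.
\<close>
lemma (in grid) exists_near_equal:
  assumes even_F: "\<And>x. norm x = 1 \<Longrightarrow> F (- x) = F x"
  shows "\<exists>P\<in>{0..pi} \<times> {0..pi} \<times> {0..pi}. \<forall>k\<in>{0..<4}.
    \<exists>Q. dist Q P \<le> 9 * pi / (2 * n) \<and> (\<forall>j\<in>{0..<4}. vertex_value F j Q \<le> vertex_value F k Q)"
proof -
  define h where "h = (\<lambda>v. SOME k. k \<in> {0..<4} \<and> (\<forall>j\<in>{0..<4}. vertex_value F j (angles v) \<le> vertex_value F k (angles v)))"
  have h: "h v \<in> {0..<4} \<and> (\<forall>j\<in>{0..<4}. vertex_value F j (angles v) \<le> vertex_value F (h v) (angles v))" for v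
  proof -
    let ?f = "\<lambda>j. vertex_value F j (angles v)"
    have "Max (?f ` {0..<4}) \<in> ?f ` {0..<4}" by (intro Max_in) auto
    then obtain k where k: "k \<in> {0..<4}" "Max (?f ` {0..<4}) = ?f k" by blast
    have "?f j \<le> ?f k" if "j \<in> {0..<4}" for j
      unfolding k(2)[symmetric] using that by (intro Max_ge) auto
    then have "\<exists>k. k \<in> {0..<4} \<and> (\<forall>j\<in>{0..<4}. ?f j \<le> ?f k)" using k(1) by blast
    then show ?thesis unfolding h_def by (rule someI_ex)
  qed
  have ext: "vertex_value F j (angles v) \<le> vertex_value F (extend h v) (angles v)" if j: "j \<in> {0..<4}" for j v
  proof -
    obtain j' where j': "j' \<in> {0..<4}" "j = lab (tile v) j'" using j lab_image[of "tile v"] by blast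
    have act: "vertex_value F (lab (tile v) k) (angles v) = vertex_value F k (angles (rep v))" for k
      using vertex_value_act[of F "tile v" k "rep v", OF even_F] by (simp add: act_tile_rep)
    show ?thesis unfolding j'(2) extend_def act using h j'(1) by blast
  qed
  obtain C where C: "chamber C" "rainbow h C" "C ! 0 \<in> box"
    using exists_rainbow[of h] h by blast
  show ?thesis
  proof (intro bexI[where x = "angles (C ! 0)"] ballI)
    obtain x y z where a: "C ! 0 = (x, y, z)" by (metis prod.exhaust)
    have b: "0 \<le> x" "x \<le> 2 * n" "0 \<le> y" "y \<le> 2 * n" "0 \<le> z" "z \<le> 2 * n"
      using C(3) by (auto simp: a box_def)
    have "real_of_int u * pi / (2 * n) \<in> {0..pi}" if "0 \<le> u" "u \<le> 2 * n" for u
    proof -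
      have "real_of_int u \<le> 2 * n" using that by linarith
      then show ?thesis using that n_pos by (simp add: field_simps)
    qed
    with b show "angles (C ! 0) \<in> {0..pi} \<times> {0..pi} \<times> {0..pi}" by (simp only: a angles_def case_prod_conv mem_Times_iff fst_conv snd_conv)
    fix k :: int assume "k \<in> {0..<4}"
    then obtain v where "v \<in> set C" "k = extend h v" using C(2) unfolding rainbow_def by blast
    then show "\<exists>Q. dist Q (angles (C ! 0)) \<le> 9 * pi / (2 * n) \<and> (\<forall>j\<in>{0..<4}. vertex_value F j Q \<le> vertex_value F k Q)"
      using ext chamber_near[OF C(1)] by blast
  qed
qed

text \<open>
  As the grid is refined, all vertices of the rainbow chambers converge along a subsequence to one point. There each
  of the four values is at least each other.
\<close>
lemma exists_euler_equal:
  assumes even_F: "\<And>x. norm x = 1 \<Longrightarrow> F (- x) = F x"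
    and cont: "continuous_on (sphere 0 1) F"
  obtains P where "\<And>j k. j \<in> {0..<4} \<Longrightarrow> k \<in> {0..<4} \<Longrightarrow> vertex_value F j P = vertex_value F k P"
proof -
  (* The m-th grid has n = 2 * (m + 1), and e m bounds the distance of the vertices of a chamber to its first vertex. *)
  define e where "e = (\<lambda>m. 9 * pi / real_of_int (2 * (2 * int (Suc m))))"
  have "\<exists>P\<in>{0..pi} \<times> {0..pi} \<times> {0..pi}. \<forall>k\<in>{0..<4}. \<exists>Q. dist Q P \<le> e m \<and>
      (\<forall>j\<in>{0..<4}. vertex_value F j Q \<le> vertex_value F k Q)" for m
  proof -
    interpret grid "2 * int (Suc m)" by standard auto
    show ?thesis unfolding e_def by (rule exists_near_equal) (rule even_F)
  qed
  then obtain P where P: "\<And>m. P m \<in> {0..pi} \<times> {0..pi} \<times> {0..pi}"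
    and "\<And>m. \<forall>k\<in>{0..<4}. \<exists>Q. dist Q (P m) \<le> e m \<and> (\<forall>j\<in>{0..<4}. vertex_value F j Q \<le> vertex_value F k Q)"
    by metis
  then obtain Q where Q: "\<And>m k. k \<in> {0..<4} \<Longrightarrow> dist (Q m k) (P m) \<le> e m"
    "\<And>m k j. k \<in> {0..<4} \<Longrightarrow> j \<in> {0..<4} \<Longrightarrow> vertex_value F j (Q m k) \<le> vertex_value F k (Q m k)"
    by metis
  have "compact ({0..pi} \<times> {0..pi} \<times> {0..pi})" by (intro compact_Times) auto
  then obtain l r where lr: "strict_mono r" "(P \<circ> r) \<longlonglongrightarrow> l"
    using P unfolding compact_def by metis
  have e: "e \<longlonglongrightarrow> 0"
  proof -
    have "(\<lambda>m. (9 * pi / 4) * inverse (real (Suc m))) \<longlonglongrightarrow> (9 * pi / 4) * 0"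
      by (intro tendsto_intros LIMSEQ_inverse_real_of_nat)
    then show ?thesis unfolding e_def by (simp add: field_simps)
  qed
  have Ql: "(\<lambda>m. Q (r m) k) \<longlonglongrightarrow> l" if "k \<in> {0..<4}" for k
  proof -
    have "(\<lambda>m. dist (Q (r m) k) (P (r m))) \<longlonglongrightarrow> 0"
    proof (rule tendsto_sandwich[where f = "\<lambda>_. 0" and h = "\<lambda>m. e (r m)"])
      show "(\<lambda>m. e (r m)) \<longlonglongrightarrow> 0" using LIMSEQ_subseq_LIMSEQ[OF e lr(1)] by (simp add: comp_def)
    qed (use Q(1)[OF that] in auto)
    then have "(\<lambda>m. Q (r m) k - P (r m)) \<longlonglongrightarrow> 0"
      unfolding dist_norm by (rule tendsto_norm_zero_cancel)
    from tendsto_add[OF lr(2)[unfolded comp_def] this] show ?thesis by simp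
  qed
  have "vertex_value F j l \<le> vertex_value F k l" if "j \<in> {0..<4}" "k \<in> {0..<4}" for j k
  proof (rule LIMSEQ_le)
    have c: "isCont (vertex_value F i) l" for i
      using continuous_vertex_value[OF cont, of i] continuous_on_eq_continuous_at[OF open_UNIV] by blast
    show "(\<lambda>m. vertex_value F j (Q (r m) k)) \<longlonglongrightarrow> vertex_value F j l"
      "(\<lambda>m. vertex_value F k (Q (r m) k)) \<longlonglongrightarrow> vertex_value F k l"
      by (rule isCont_tendsto_compose[OF c Ql[OF that(2)]])+
    show "\<exists>N. \<forall>m\<ge>N. vertex_value F j (Q (r m) k) \<le> vertex_value F k (Q (r m) k)"
      using Q(2) that by blast
  qed
  then show ?thesis by (intro that order_antisym)
qed

theorem theorem1:
  fixes F :: "real^3 \<Rightarrow> real" and v1 v2 v3 v4 :: "real^3"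
  assumes "continuous_on (sphere 0 1) F"
    and "\<forall>x\<in>sphere 0 1. F x = F (- x)"
    and "is_cube_vertex_set {v1, - v1, v2, - v2, v3, - v3, v4, - v4}"
    and "{v1, - v1, v2, - v2, v3, - v3, v4, - v4} \<subseteq> sphere 0 1"
  shows "\<exists>A :: real^3^3. rotation_matrix A \<and>
           F (A *v v1) = F (A *v v2) \<and> F (A *v v2) = F (A *v v3) \<and> F (A *v v3) = F (A *v v4)"
proof -
  have even_F: "F (- x) = F x" if "norm x = 1" for x
    using bspec[OF assms(2), of x] that by (simp only: mem_sphere_0)
  obtain B :: "real^3^3" where B: "rotation_matrix B"
    "\<And>v. v \<in> {v1, - v1, v2, - v2, v3, - v3, v4, - v4} \<Longrightarrow>
      \<exists>k\<in>{0..<4::int}. B *v v = rotz (k * pi / 2) *v diag \<or> B *v v = - (rotz (k * pi / 2) *v diag)"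
    using inscribed_cube_onto_reference[OF assms(3,4)] by blast
  obtain P where P: "\<And>j k. j \<in> {0..<4} \<Longrightarrow> k \<in> {0..<4} \<Longrightarrow> vertex_value F j P = vertex_value F k P"
    using exists_euler_equal[OF even_F assms(1)] by blast
  have val: "F ((euler P ** B) *v v) = vertex_value F 0 P" if v: "v \<in> {v1, - v1, v2, - v2, v3, - v3, v4, - v4}" for v
  proof -
    obtain k :: int where k: "k \<in> {0..<4}"
      "B *v v = rotz (k * pi / 2) *v diag \<or> B *v v = - (rotz (k * pi / 2) *v diag)" using B(2)[OF v] by blast
    have "norm (euler P *v (rotz (k * pi / 2) *v diag)) = 1"
      using rotation_euler[of P] rotation_rotz by (simp add: norm_orthogonal rotation_matrix_def norm_diag)
    then have "F (- (euler P *v (rotz (k * pi / 2) *v diag))) = vertex_value F k P"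
      unfolding vertex_value_def by (rule even_F)
    with k(2) have "F (euler P *v (B *v v)) = vertex_value F k P"
      by (elim disjE) (simp_all only: vertex_value_def matrix_vector_mult_minus)
    also have "\<dots> = vertex_value F 0 P" by (rule P) (use k(1) in simp_all)
    finally show ?thesis by (simp add: matrix_vector_mul_assoc)
  qed
  have "F ((euler P ** B) *v v1) = vertex_value F 0 P" "F ((euler P ** B) *v v2) = vertex_value F 0 P"
    "F ((euler P ** B) *v v3) = vertex_value F 0 P" "F ((euler P ** B) *v v4) = vertex_value F 0 P"
    by (rule val, blast)+
  note eqs = this
  show ?thesis
    by (intro exI[of _ "euler P ** B"] conjI rotation_mult rotation_euler B(1)) (simp_all only: eqs)
qed

end
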